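(* Let $n\ge1$, $d_2=(0,1,0)$, $d_3=(0,0,1)$, and let $\tau_1\subset U^{\mathrm{trop}}=\mathbb{R}^3$ be the cone generated by $d_2$, $d_3$ and $(n,n,1)$. Then the integral points of the dual cone $\tau_1^\star$ correspond to theta functions generating the coordinate ring of the affine variety $$W_1=\operatorname{Spec}\mathbb{C}[\tau_1^\star\cap V^{\mathrm{trop}}(\mathbb{Z})],\qquad \mathbb{C}[W_1]=\mathbb{C}[x,y,y^{-1}z,t]\big/\big(xz-y(y+t^n)\big),$$ i.e. $\mathbb{C}[W_1]$ is the subring of $\mathbb{C}[U]$ generated by $x,y,y^{-1}z,t$, and $W_1$ is one affine patch of one side of the flop over $(P\in Y)$.
   Context: Let $Y=\{xz=y(y+t^n)\}\subset\mathbb{A}^4_{x,y,z,t}$ over $\mathbb{C}$, $P=0$, and $U=Y\setminus\{yt=0\}$, so $\mathbb{C}[U]=\mathbb{C}[x,y^{\pm1},z,t^{\pm1}]/(xz-y(y+t^n))$. The two sides of the flop over $P$ are the small resolutions of $Y$ given by blowing up the Weil divisor $\{x=y=0\}$ or $\{y=z=0\}$. For the blowup $X\to Y$ of $\{y=z=0\}$, the standard affine patches have coordinate rings $\mathbb{C}[Y][y^{-1}z]$ and $\mathbb{C}[Y][yz^{-1}]$ (subrings of $\mathbb{C}(Y)$). Theta functions on $U$ are the elements of the set $S_1\cup S_2$, where $S_1=\{x^iy^jt^k:i\in\mathbb{Z}_{\ge0},\ j,k\in\mathbb{Z}\}$ and $S_2=\{z^iy^jt^k:i\in\mathbb{Z}_{\ge0},\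 j,k\in\mathbb{Z}\}$; this set is a $\mathbb{C}$-basis of $\mathbb{C}[U]$. The set $V^{\mathrm{trop}}(\mathbb{Z})$ of integral points of $V^{\mathrm{trop}}$ is identified with $S_1\cup S_2$; here $V^{\mathrm{trop}}$ is obtained by gluing two copies $V_1,V_2$ of $\mathbb{R}_{\ge0}\times\mathbb{R}^2$ (with integral points $S_1,S_2$, coordinates being exponents $(i,j,k)$) along $\{0\}\times\mathbb{R}^2$. The set $U^{\mathrm{trop}}(\mathbb{Z})$ is identified with $\mathbb{Z}^3\subset U^{\mathrm{trop}}=\mathbb{R}^3$, where $(a,b,c)$ corresponds to the monomial valuation on $\mathbb{C}(U)=\mathbb{C}(x,y,t)$ with $x\mapsto a,\ y\mapsto b,\ t\mapsto c$. The pairing $\langle\nu,\vartheta\rangle=\nu(\vartheta)$ on $U^{\mathrm{trop}}(\mathbb{Z})\times V^{\mathrm{trop}}(\mathbb{Z})$, extended by scaling and continuity to $U^{\mathrm{trop}}\times V^{\mathrm{trop}}\to\mathbb{R}$, is therefore $$\langle(a,b,c),x^iy^jt^k\rangle=ia+jb+kc,\qquad \langle(a,b,c),z^iy^jt^k\rangle=i\big(b+\min(b,nc)-a\big)+jb+kc .$$ For a cone $\tau\subset U^{\mathrm{trop}}$, $\tau^\star=\{v\in V^{\mathrm{trop}}:\langle u,v\rangle\ge0\text{ for all }u\in\tau\}$, and $\mathbb{C}[\tau^\star\cap V^{\mathrm{trop}}(\mathbb{Z})]$ denotes the subspace of $\mathbb{C}[U]$ spanned by the theta functions in $\tau^\star$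 (a subring when $\tau$ is convex in $U^{\mathrm{trop}}$, as $\tau_1$ is). *)

theory Defs
  imports
    "HOL-Analysis.Analysis"
    "HOL-Algebra.Algebra"
    "HOL-Library.Poly_Mapping"
    "HOL-Library.Product_Plus"
begin

section \<open>The coordinate rings of Y and U\<close>

text \<open>
  The exponent vector \<open>(i, j, k, l)\<close> stands for the monomial \<open>x^i y^j z^k t^l\<close>.
  With \<open>'e = nat\<close> the type \<open>'e xyzt_poly\<close> is the polynomial ring \<open>C[x,y,z,t]\<close>, with \<open>'e = int\<close>
  it is \<open>C[x,y^{+1,-1},z,t^{+1,-1}]\<close>; the product of \<open>poly_mapping\<close> is convolution.
\<close>

type_synonym 'e xyzt_poly = "(nat \<times> 'e \<times> nat \<times> 'e) \<Rightarrow>\<^sub>0 complex"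

definition xyzt_ring :: "('e::comm_monoid_add) xyzt_poly ring" where
  "xyzt_ring = \<lparr>carrier = UNIV, mult = (*), one = 1, ring.zero = 0, ring.add = (+)\<rparr>"

definition xyzt_monom :: "nat \<Rightarrow> 'e \<Rightarrow> nat \<Rightarrow> 'e \<Rightarrow> ('e::comm_monoid_add) xyzt_poly" where
  "xyzt_monom i j k l = Poly_Mapping.single (i, j, k, l) 1"

definition xyzt_const :: "complex \<Rightarrow> ('e::comm_monoid_add) xyzt_poly" where
  "xyzt_const c = Poly_Mapping.single 0 c"

definition Y_equation :: "nat \<Rightarrow> ('e::{comm_monoid_add,one}) xyzt_poly" where
  "Y_equation n =
     xyzt_monom 1 0 0 0 * xyzt_monom 0 0 1 0
     - xyzt_monom 0 1 0 0 * (xyzt_monom 0 1 0 0 + xyzt_monom 0 0 0 1 ^ n)"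

definition coord_ring :: "nat \<Rightarrow> ('e::{comm_monoid_add,one}) xyzt_poly set ring" where
  "coord_ring n = xyzt_ring Quot (PIdl\<^bsub>xyzt_ring\<^esub> (Y_equation n))"

abbreviation CY :: "nat \<Rightarrow> nat xyzt_poly set ring" where
  "CY \<equiv> coord_ring"

abbreviation CU :: "nat \<Rightarrow> int xyzt_poly set ring" where
  "CU \<equiv> coord_ring"

definition residue_class :: "nat \<Rightarrow> ('e::{comm_monoid_add,one}) xyzt_poly \<Rightarrow> 'e xyzt_poly set" where
  "residue_class n p = (PIdl\<^bsub>xyzt_ring\<^esub> (Y_equation n)) +>\<^bsub>xyzt_ring\<^esub> p"

definition monom_class ::
    "nat \<Rightarrow> nat \<Rightarrow> 'e \<Rightarrow> nat \<Rightarrow> 'e \<Rightarrow> ('e::{comm_monoid_add,one}) xyzt_poly set" where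
  "monom_class n i j k l = residue_class n (xyzt_monom i j k l)"

definition scalars :: "nat \<Rightarrow> ('e::{comm_monoid_add,one}) xyzt_poly set set" where
  "scalars n = range (\<lambda>c. residue_class n (xyzt_const c))"


section \<open>Tropical sets, pairing and dual cones\<close>

text \<open>
  \<open>Chart1 i j k\<close> and \<open>Chart2 i j k\<close> are the points with coordinates \<open>(i, j, k)\<close> of the two copies
  of \<open>R_{\<ge>0} \<times> R^2\<close>; those with \<open>i < 0\<close> lie outside the field of \<open>vtrop_rel\<close> and are not
  points of \<open>vtrop\<close>.
\<close>

datatype vtrop_chart = Chart1 real real real | Chart2 real real real

fun vtrop_rel :: "vtrop_chart \<Rightarrow> vtrop_chart \<Rightarrow> bool" where
  "vtrop_rel (Chart1 i j k) (Chart1 i' j' k') \<longleftrightarrow> 0 \<le> i \<and> i = i' \<and> j = j' \<and> k = k'"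
| "vtrop_rel (Chart2 i j k) (Chart2 i' j' k') \<longleftrightarrow> 0 \<le> i \<and> i = i' \<and> j = j' \<and> k = k'"
| "vtrop_rel (Chart1 i j k) (Chart2 i' j' k') \<longleftrightarrow> i = 0 \<and> i' = 0 \<and> j = j' \<and> k = k'"
| "vtrop_rel (Chart2 i j k) (Chart1 i' j' k') \<longleftrightarrow> i = 0 \<and> i' = 0 \<and> j = j' \<and> k = k'"

quotient_type vtrop = vtrop_chart / partial: vtrop_rel
proof (rule part_equivpI)
  show "\<exists>p. vtrop_rel p p"
    by (rule exI[of _ "Chart1 0 0 0"]) simp
  show "symp vtrop_rel"
  proof (rule sympI)
    fix p q show "vtrop_rel p q \<Longrightarrow> vtrop_rel q p"
      by (cases p; cases q) auto
  qed
  show "transp vtrop_rel"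
  proof (rule transpI)
    fix p q r show "vtrop_rel p q \<Longrightarrow> vtrop_rel q r \<Longrightarrow> vtrop_rel p r"
      by (cases p; cases q; cases r) auto
  qed
qed

type_synonym utrop = "real \<times> real \<times> real"

text \<open>
  The point \<open>(a, b, c)\<close> is the monomial valuation of \<open>C(x,y,t)\<close> with values \<open>a, b, c\<close> on
  \<open>x, y, t\<close>. It takes the value \<open>b + min b (n c) - a\<close> on \<open>z = y (y + t^n) / x\<close>.
\<close>

fun chart_pairing :: "nat \<Rightarrow> utrop \<Rightarrow> vtrop_chart \<Rightarrow> real" where
  "chart_pairing n (a, b, c) (Chart1 i j k) = i * a + j * b + k * c"
| "chart_pairing n (a, b, c) (Chart2 i j k) = i * (b + min b (real n * c) - a) + j * b + k * c"

lift_definition trop_pairing :: "nat \<Rightarrow> utrop \<Rightarrow> vtrop \<Rightarrow> real" is chart_pairing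
proof -
  fix n u p q show "vtrop_rel p q \<Longrightarrow> chart_pairing n u p = chart_pairing n u q"
    by (cases u; cases p; cases q) auto
qed

definition dual_cone :: "nat \<Rightarrow> utrop set \<Rightarrow> vtrop set" where
  "dual_cone n \<tau> = {v. \<forall>u\<in>\<tau>. trop_pairing n u v \<ge> 0}"

definition tau1 :: "nat \<Rightarrow> utrop set" where
  "tau1 n = convex_cone hull {(0, 1, 0), (0, 0, 1), (real n, real n, 1)}"


section \<open>Theta functions and their span\<close>

definition theta_functions_in :: "nat \<Rightarrow> vtrop set \<Rightarrow> int xyzt_poly set set" where
  "theta_functions_in n C =
     {monom_class n i j 0 k | i j k. abs_vtrop (Chart1 (real i) (of_int j) (of_int k)) \<in> C} \<union>
     {monom_class n 0 j i k | i j k. abs_vtrop (Chart2 (real i) (of_int j) (of_int k)) \<in> C}"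

definition linear_span :: "('a, 'b) ring_scheme \<Rightarrow> 'a set \<Rightarrow> 'a set \<Rightarrow> 'a set" where
  "linear_span R K S = (\<Union>Us\<in>{Us. set Us \<subseteq> S}. ring.Span R K Us)"

definition theta_span :: "nat \<Rightarrow> vtrop set \<Rightarrow> int xyzt_poly set set" where
  "theta_span n C = linear_span (CU n) (scalars n) (theta_functions_in n C)"

definition CW1 :: "nat \<Rightarrow> int xyzt_poly set ring" where
  "CW1 n = (CU n)\<lparr>carrier := theta_span n (dual_cone n (tau1 n))\<rparr>"


section \<open>Fraction fields and affine patches of blowups\<close>

definition frac_class :: "('a, 'b) ring_scheme \<Rightarrow> 'a \<Rightarrow> 'a \<Rightarrow> ('a \<times> 'a) set" where
  "frac_class R a b =
     {(c, d). c \<in> carrier R \<and> d \<in> carrier R - {\<zero>\<^bsub>R\<^esub>} \<and> a \<otimes>\<^bsub>R\<^esub> d = c \<otimes>\<^bsub>R\<^esub> b}"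

definition fraction_field :: "('a, 'b) ring_scheme \<Rightarrow> ('a \<times> 'a) set ring" where
  "fraction_field R =
     \<lparr>carrier = {frac_class R a b | a b. a \<in> carrier R \<and> b \<in> carrier R - {\<zero>\<^bsub>R\<^esub>}},
      mult = (\<lambda>A B. \<Union>(a, b)\<in>A. \<Union>(c, d)\<in>B. frac_class R (a \<otimes>\<^bsub>R\<^esub> c) (b \<otimes>\<^bsub>R\<^esub> d)),
      one = frac_class R \<one>\<^bsub>R\<^esub> \<one>\<^bsub>R\<^esub>,
      ring.zero = frac_class R \<zero>\<^bsub>R\<^esub> \<one>\<^bsub>R\<^esub>,
      ring.add = (\<lambda>A B. \<Union>(a, b)\<in>A. \<Union>(c, d)\<in>B.
        frac_class R (a \<otimes>\<^bsub>R\<^esub> d \<oplus>\<^bsub>R\<^esub> c \<otimes>\<^bsub>R\<^esub> b) (b \<otimes>\<^bsub>R\<^esub> d))\<rparr>"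

text \<open>
  For a domain \<open>R\<close> and the ideal generated by \<open>G\<close>, the blowup of \<open>Spec R\<close> along that ideal is covered
  by the affine patches \<open>Spec R[g/f : g \<in> G]\<close>, where \<open>f\<close> ranges over the nonzero elements of \<open>G\<close>.
  The ring \<open>R[g/f : g \<in> G]\<close> is a subring of the fraction field.
\<close>

definition blowup_patch_ring ::
    "('a, 'b) ring_scheme \<Rightarrow> 'a set \<Rightarrow> 'a \<Rightarrow> ('a \<times> 'a) set ring" where
  "blowup_patch_ring R G f = (fraction_field R)
     \<lparr>carrier := generate_ring (fraction_field R)
       ({frac_class R r \<one>\<^bsub>R\<^esub> | r. r \<in> carrier R} \<union> {frac_class R g f | g. g \<in> G})\<rparr>"

end

theory Submission
  imports Defs "HOL-Computational_Algebra.Formal_Laurent_Series"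
begin

text \<open>
  Put \<open>u = z / y\<close>. On \<open>U\<close> the equation \<open>x z = y (y + t^n)\<close> becomes \<open>x u = y + t^n\<close>, and the
  claim is that the theta functions in the dual cone span exactly the image of the polynomial ring
  \<open>C[x, y, u, t]\<close> in \<open>C[U]\<close>. That image is \<open>range (patch_class n)\<close> below, and each of the three rings
  in the theorem is identified with it.

  The pairing is concave in its first argument, because \<open>min\<close> occurs with the nonnegative factor
  \<open>i\<close>, so nonnegativity on \<open>tau1 n\<close> need only be tested on the three generators. The two unit vectors
  give \<open>0 \<le> j\<close>, \<open>0 \<le> k\<close> on the first chart and \<open>0 \<le> i + j\<close>, \<open>0 \<le> k\<close> on the second, and these
  imply the inequality of the third generator. The corresponding theta functions are \<open>x^i y^j t^k\<close> and
  \<open>z^i y^j t^k = u^i y^(i + j) t^k\<close>: exactly the monomials in \<open>x, y, u, t\<close> in which \<open>x\<close> and \<open>u\<close> do not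
  both occur (\<open>theta_functions_in_dual_cone_tau1\<close>). Rewriting \<open>x u\<close> as \<open>y + t^n\<close> turns every
  polynomial into a combination of these (\<open>normal_form\<close>), so their span is the whole image
  (\<open>theta_span_dual_cone_tau1\<close>).

  To compare with the fraction field of \<open>C[Y]\<close>, both \<open>C[Y]\<close> and \<open>C[U]\<close> are embedded in one field, with
  \<open>x, y, t\<close> independent and \<open>z\<close> sent to \<open>y (y + t^n) / x\<close>. The field consists of iterated Laurent
  series, so that coefficients can be read off. Evaluation is injective modulo the equation because
  a polynomial without a monomial divisible by \<open>x z\<close> can be recovered from its value: the power of
  \<open>x\<close> in the value determines the exponents of \<open>x\<close> and \<open>z\<close> (\<open>normal_form_ext_eq_0\<close>, \<open>ext_eq_0_iff\<close>).
  This shows that the coordinate rings are domains. It also makes the elements of the fraction field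
  of \<open>C[Y]\<close> correspond to quotients of values, and the isomorphism sends an element of \<open>C[U]\<close> to the
  fraction that has the same value (\<open>patch_iso\<close>).
\<close>

section \<open>Homomorphisms out of monoid algebras\<close>

lemma poly_mapping_monomial_induct [case_names zero single_add]:
  fixes p :: "'m \<Rightarrow>\<^sub>0 'c::comm_monoid_add"
  assumes "P 0" and "\<And>m c p. P p \<Longrightarrow> P (Poly_Mapping.single m c + p)"
  shows "P p"
proof (induction p rule: update_induct)
  case const
  show ?case by (fact assms(1))
next
  case (update f a b)
  have "Poly_Mapping.update a b f = Poly_Mapping.single a b + f"
    using update(1)
    by (intro poly_mapping_eqI) (auto simp: lookup_add lookup_update lookup_single in_keys_iff when_def)
  then show ?case
    using assms(2)[OF update(3)] by simp
qed

lemma sum_single_lookup: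
  "(\<Sum>m\<in>Poly_Mapping.keys p. Poly_Mapping.single m (Poly_Mapping.lookup p m)) = p"
  by (rule poly_mapping_eqI)
     (simp add: lookup_sum lookup_single when_def in_keys_iff)

text \<open>
  The universal property of the monoid algebra: a ring homomorphism on the coefficients and a monoid
  homomorphism on the exponents extend to a ring homomorphism on \<open>'m \<Rightarrow>\<^sub>0 'c\<close>.
\<close>
locale monoid_algebra_hom =
  fixes \<kappa> :: "'c::comm_ring_1 \<Rightarrow> 'a::comm_ring_1" and g :: "'m::comm_monoid_add \<Rightarrow> 'a"
  assumes \<kappa>_add: "\<kappa> (a + b) = \<kappa> a + \<kappa> b"
    and \<kappa>_mult: "\<kappa> (a * b) = \<kappa> a * \<kappa> b"
    and \<kappa>_one: "\<kappa> 1 = 1"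
    and g_zero: "g 0 = 1"
    and g_add: "g (m + m') = g m * g m'"
begin

definition ext :: "('m \<Rightarrow>\<^sub>0 'c) \<Rightarrow> 'a" where
  "ext p = (\<Sum>m\<in>Poly_Mapping.keys p. \<kappa> (Poly_Mapping.lookup p m) * g m)"

lemma \<kappa>_zero: "\<kappa> 0 = 0"
  using \<kappa>_add[of 0 0] by simp

lemma ext_zero [simp]: "ext 0 = 0"
  by (simp add: ext_def)

lemma ext_single [simp]: "ext (Poly_Mapping.single m c) = \<kappa> c * g m"
  by (simp add: ext_def \<kappa>_zero)

lemma ext_add [simp]: "ext (p + q) = ext p + ext q"
  unfolding ext_def
  by (rule setsum_keys_plus_distrib) (simp_all add: \<kappa>_zero \<kappa>_add algebra_simps)

lemma ext_uminus [simp]: "ext (- p) = - ext p"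
  using ext_add[of p "- p"] by (simp add: eq_neg_iff_add_eq_0 add.commute)

lemma ext_diff [simp]: "ext (p - q) = ext p - ext q"
  using ext_add[of p "- q"] by simp

lemma ext_one [simp]: "ext 1 = 1"
  using ext_single[of 0 1] by (simp add: \<kappa>_one g_zero)

lemma ext_mult [simp]: "ext (p * q) = ext p * ext q"
proof (induction p rule: poly_mapping_monomial_induct)
  case (single_add m c p)
  have "ext (Poly_Mapping.single m c * q) = \<kappa> c * g m * ext q"
    by (induction q rule: poly_mapping_monomial_induct)
       (simp_all add: distrib_left mult_single \<kappa>_mult g_add algebra_simps)
  then show ?case
    using single_add by (simp add: distrib_right)
qed simp

lemma ext_power [simp]: "ext (p ^ k) = ext p ^ k"
  by (induction k) simp_all

end

lemmas xyzt_simps = xyzt_monom_def xyzt_const_def mult_single add_Pair zero_prod_def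

lemma single_eq_xyzt_product:
  fixes i j k l :: nat
  shows "Poly_Mapping.single (i, j, k, l) c = xyzt_const c * xyzt_monom 1 0 0 0 ^ i
      * xyzt_monom 0 1 0 0 ^ j * xyzt_monom 0 0 1 0 ^ k * xyzt_monom 0 0 0 1 ^ l"
proof -
  have "xyzt_monom 1 0 0 0 ^ i = xyzt_monom i (0::nat) 0 0"
    by (induction i) (simp_all add: xyzt_simps flip: single_one)
  moreover have "xyzt_monom 0 1 0 0 ^ j = xyzt_monom 0 j 0 0"
    by (induction j) (simp_all add: xyzt_simps flip: single_one)
  moreover have "xyzt_monom 0 0 1 0 ^ k = xyzt_monom 0 (0::nat) k 0"
    by (induction k) (simp_all add: xyzt_simps flip: single_one)
  moreover have "xyzt_monom 0 0 0 1 ^ l = xyzt_monom 0 0 0 l"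
    by (induction l) (simp_all add: xyzt_simps flip: single_one)
  ultimately show ?thesis
    by (simp add: xyzt_simps)
qed

text \<open>
  A subring given by generators is easiest to handle as the image of \<open>C[x, y, z, t]\<close>. The hypotheses
  on \<open>h\<close> are bare equations about the operations of \<open>R\<close>, so that the rule applies to
  \<open>fraction_field\<close> as soon as its operations are computed on values.
\<close>
lemma generate_ring_eq_range:
  fixes h :: "nat xyzt_poly \<Rightarrow> 'b" and R :: "('b, 'd) ring_scheme"
  assumes add: "\<And>p q. h (p + q) = h p \<oplus>\<^bsub>R\<^esub> h q"
    and mult: "\<And>p q. h (p * q) = h p \<otimes>\<^bsub>R\<^esub> h q"
    and one: "h 1 = \<one>\<^bsub>R\<^esub>"
    and minus: "\<And>p. h (- p) = \<ominus>\<^bsub>R\<^esub> h p"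
    and const: "\<And>c. h (xyzt_const c) \<in> G"
    and vars: "h (xyzt_monom 1 0 0 0) \<in> G" "h (xyzt_monom 0 1 0 0) \<in> G"
      "h (xyzt_monom 0 0 1 0) \<in> G" "h (xyzt_monom 0 0 0 1) \<in> G"
    and G: "G \<subseteq> range h"
  shows "generate_ring R G = range h"
proof
  show "generate_ring R G \<subseteq> range h"
  proof
    fix a assume "a \<in> generate_ring R G"
    then show "a \<in> range h"
    proof (induction rule: generate_ring.induct)
      case (a_inv a)
      then show ?case by (auto simp flip: minus)
    next
      case (eng_add a b)
      then show ?case by (auto simp flip: add)
    next
      case (eng_mult a b)
      then show ?case by (auto simp flip: mult)
    qed (use G in \<open>auto simp flip: one\<close>)
  qed
  have pow: "h (p ^ k) \<in> generate_ring R G" if "h p \<in> generate_ring R G" for p k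
    by (induction k) (use that in \<open>auto simp: one mult intro: generate_ring.intros\<close>)
  show "range h \<subseteq> generate_ring R G"
  proof clarify
    fix p
    show "h p \<in> generate_ring R G"
    proof (induction p rule: poly_mapping_monomial_induct)
      case zero
      have "h 0 = h 1 \<oplus>\<^bsub>R\<^esub> h (- 1)"
        by (simp flip: add)
      then show ?case
        by (simp add: minus one generate_ring.eng_add generate_ring.a_inv generate_ring.one)
    next
      case (single_add m c p)
      obtain i j k l where m: "m = (i, j, k, l)" by (cases m)
      have "h (Poly_Mapping.single m c) \<in> generate_ring R G"
        unfolding m single_eq_xyzt_product mult
        by (intro generate_ring.eng_mult pow generate_ring.incl const vars)
      then show ?case
        unfolding add by (rule generate_ring.eng_add[OF _ single_add])
    qed
  qed
qed


section \<open>Normal forms modulo x z = g(y, t)\<close>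

definition yt_poly :: "('e::comm_monoid_add) xyzt_poly \<Rightarrow> bool" where
  "yt_poly p \<longleftrightarrow> (\<forall>m\<in>Poly_Mapping.keys p. \<exists>j l. m = (0, j, 0, l))"

definition xz_free :: "('e::comm_monoid_add) xyzt_poly \<Rightarrow> bool" where
  "xz_free p \<longleftrightarrow> (\<forall>(i, j, k, l)\<in>Poly_Mapping.keys p. i = 0 \<or> k = 0)"

lemma yt_poly_monom: "yt_poly (xyzt_monom 0 j 0 l)"
  by (simp add: yt_poly_def xyzt_monom_def)

lemma yt_poly_add: "yt_poly p \<Longrightarrow> yt_poly q \<Longrightarrow> yt_poly (p + q)"
  using keys_add[of p q] by (auto simp: yt_poly_def)

lemma yt_poly_mult: "yt_poly p \<Longrightarrow> yt_poly q \<Longrightarrow> yt_poly (p * q)"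
  unfolding yt_poly_def using keys_mult[of p q] by fastforce

lemma yt_poly_power: "yt_poly p \<Longrightarrow> yt_poly (p ^ k)"
proof (induction k)
  case 0
  show ?case by (simp add: yt_poly_def zero_prod_def flip: single_one)
qed (simp add: yt_poly_mult)

lemma xz_free_add: "xz_free p \<Longrightarrow> xz_free q \<Longrightarrow> xz_free (p + q)"
  using keys_add[of p q] by (auto simp: xz_free_def)

text \<open>
  Division with remainder by \<open>x z - g(y, t)\<close>. It is stated for general \<open>g\<close> because it is used twice:
  with \<open>g = y (y + t^n)\<close> for the coordinate rings, and with \<open>g = y + t^n\<close> for the patch, where the third
  variable stands for \<open>z / y\<close>. Replacing \<open>x z\<close> by \<open>g\<close> lowers the exponent of \<open>x\<close>, since \<open>g\<close> does not
  involve \<open>x\<close>.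
\<close>
lemma normal_form:
  assumes g: "yt_poly g"
  shows "\<exists>r. xz_free r \<and> (xyzt_monom 1 0 1 0 - g) dvd (p - r)"
proof -
  let ?f = "xyzt_monom 1 0 1 0 - g"
  define N where "N p \<longleftrightarrow> (\<exists>r. xz_free r \<and> ?f dvd (p - r))" for p
  have zero: "N 0"
    unfolding N_def by (rule exI[of _ 0]) (simp add: xz_free_def)
  have add: "N (p + q)" if "N p" "N q" for p q
  proof -
    from that obtain r s where "xz_free r" "xz_free s" "?f dvd (p - r)" "?f dvd (q - s)"
      unfolding N_def by blast
    then have "xz_free (r + s)" "?f dvd ((p + q) - (r + s))"
      by (auto simp: xz_free_add add_diff_add)
    then show ?thesis unfolding N_def by blast
  qed
  have monom: "N (Poly_Mapping.single (i, j, k, l) c)" for i j k l c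
  proof (induction i arbitrary: j k l c)
    case 0
    show ?case
      unfolding N_def by (rule exI[of _ "Poly_Mapping.single (0, j, k, l) c"]) (simp add: xz_free_def)
  next
    case (Suc i)
    show ?case
    proof (cases k)
      case 0
      show ?thesis
        unfolding N_def
        by (rule exI[of _ "Poly_Mapping.single (Suc i, j, k, l) c"]) (simp add: xz_free_def 0)
    next
      case (Suc k')
      let ?m = "Poly_Mapping.single (i, j, k', l) c"
      have times: "N (?m * q)" if "yt_poly q" for q
      proof -
        have "N (\<Sum>m\<in>M. ?m * Poly_Mapping.single m (Poly_Mapping.lookup q m))"
          if "finite M" "\<forall>m\<in>M. \<exists>j l. m = (0, j, 0, l)" for M
          using that
        proof (induction M)
          case (insert m M)
          then obtain j' l' where "m = (0, j', 0, l')" by blast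
          then have "N (?m * Poly_Mapping.single m (Poly_Mapping.lookup q m))"
            by (simp add: mult_single add_Pair Suc.IH)
          then show ?case
            using insert by (simp add: add)
        qed (simp add: zero)
        from this[of "Poly_Mapping.keys q"] that
        show ?thesis
          by (simp add: yt_poly_def sum_single_lookup flip: sum_distrib_left)
      qed
      have "Poly_Mapping.single (Suc i, j, k, l) c = ?m * ?f + ?m * g"
        by (simp add: algebra_simps) (simp add: xyzt_simps Suc)
      moreover have "N (?m * ?f)"
        unfolding N_def by (rule exI[of _ 0]) (simp add: xz_free_def)
      ultimately show ?thesis
        by (simp only: add times g)
    qed
  qed
  have "N p"
  proof (induction p rule: poly_mapping_monomial_induct)
    case (single_add m c p)
    obtain i j k l where "m = (i, j, k, l)" by (cases m)
    then show ?case by (simp add: add monom single_add)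
  qed (rule zero)
  then show ?thesis by (simp only: N_def)
qed


section \<open>Evaluation in a field of iterated Laurent series\<close>

text \<open>
  The field \<open>C((t))((y))((x))\<close> contains \<open>C(x, y, t)\<close>; its elements have coefficients that can be
  compared.
\<close>
type_synonym yt_field = "complex fls fls"
type_synonym xyt_field = "yt_field fls"

definition xK :: xyt_field where "xK = fls_X"
definition yF :: yt_field where "yF = fls_X"
definition tF :: yt_field where "tF = fls_const fls_X"

definition xzF :: "nat \<Rightarrow> yt_field" where
  "xzF n = yF * (yF + tF ^ n)"

definition scalarK :: "complex \<Rightarrow> xyt_field" where
  "scalarK c = fls_const (fls_const (fls_const c))"

lemma xK_nonzero [simp]: "xK \<noteq> 0" and yF_nonzero [simp]: "yF \<noteq> 0" and tF_nonzero [simp]: "tF \<noteq> 0"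
  by (simp_all add: xK_def yF_def tF_def)

lemma xzF_nonzero [simp]: "xzF n \<noteq> 0"
proof -
  have "fls_nth (yF + tF ^ n) 1 = 1"
    by (simp add: yF_def tF_def flip: fls_const_power)
  then have "yF + tF ^ n \<noteq> 0" by force
  then show ?thesis by (simp add: xzF_def)
qed

lemma fls_nth_powi_xK: "fls_nth (xK powi d * fls_const a) m = (if m = d then a else 0)"
  by (simp add: xK_def fls_X_intpow_times_conv_shift)

lemma fls_nth_powi_yF_tF:
  "fls_nth (fls_nth (fls_const (fls_const c) * (yF powi j * tF powi l)) j') l'
     = (if j' = j \<and> l' = l then c else 0)"
proof -
  have "fls_const (fls_const c) * (yF powi j * tF powi l)
     = fls_X powi j * fls_const (fls_const c * fls_X powi l)"
    by (simp add: yF_def tF_def flip: fls_const_power_int fls_const_mult_const)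
  then show ?thesis
    by (simp add: fls_X_intpow_times_conv_shift)
qed

text \<open>
  \<open>C[x, y, z, t]\<close> and \<open>C[x, y^{+1,-1}, z, t^{+1,-1}]\<close> differ only in the type of the exponents of \<open>y\<close> and \<open>t\<close>; the map
  \<open>e\<close> into the integers treats both at once.
\<close>
locale exponent_embedding =
  fixes e :: "'e::{comm_monoid_add,one} \<Rightarrow> int" and n :: nat
  assumes e_add: "e (a + b) = e a + e b" and e_one: "e 1 = 1" and e_inj: "e a = e b \<longleftrightarrow> a = b"
begin

lemma e_zero: "e 0 = 0"
  using e_add[of 0 0] by simp

fun monom_value :: "nat \<times> 'e \<times> nat \<times> 'e \<Rightarrow> xyt_field" where
  "monom_value (i, j, k, l) =
     xK powi (int i - int k) * fls_const (yF powi e j * tF powi e l * xzF n ^ k)"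

sublocale monoid_algebra_hom scalarK monom_value
proof
  fix m m' :: "nat \<times> 'e \<times> nat \<times> 'e"
  obtain i j k l i' j' k' l' where "m = (i, j, k, l)" "m' = (i', j', k', l')"
    by (metis prod.exhaust)
  then show "monom_value (m + m') = monom_value m * monom_value m'"
    by (simp add: add_Pair e_add add_diff_add power_int_add power_add flip: fls_const_mult_const)
qed (simp_all add: scalarK_def zero_prod_def e_zero fls_plus_const)

lemma ext_xyzt [simp]:
  "ext (xyzt_const c) = scalarK c"
  "ext (xyzt_monom i j k l) = monom_value (i, j, k, l)"
  using g_zero \<kappa>_one by (simp_all add: xyzt_const_def xyzt_monom_def del: monom_value.simps)

lemma ext_Y_equation: "ext (Y_equation n) = 0"
  by (simp add: Y_equation_def e_zero e_one xzF_def power_int_minus flip: fls_const_power fls_const_mult_const fls_plus_const)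

text \<open>
  The monomial \<open>x^i y^j z^k t^l\<close> has a value of degree \<open>i - k\<close> in \<open>x\<close>. When \<open>i = 0\<close> or \<open>k = 0\<close> this degree
  determines \<open>i\<close> and \<open>k\<close>, so the coefficient of the value of \<open>r\<close> at \<open>x^(i - k)\<close> is \<open>(y (y + t^n))^k\<close> times
  a Laurent polynomial in \<open>y\<close> and \<open>t\<close> whose coefficients are coefficients of \<open>r\<close>.
\<close>
lemma normal_form_ext_eq_0:
  assumes normal: "xz_free r" and "ext r = 0"
  shows "r = 0"
proof (rule ccontr)
  assume "r \<noteq> 0"
  then obtain i j k l where ijkl: "(i, j, k, l) \<in> Poly_Mapping.keys r"
    by (metis all_not_in_conv keys_eq_empty prod.exhaust)
  define c where "c = Poly_Mapping.lookup r"
  define M where "M = {m \<in> Poly_Mapping.keys r. \<exists>j l. m = (i, j, k, l)}"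
  define f :: "nat \<times> 'e \<times> nat \<times> 'e \<Rightarrow> yt_field" where
    "f = (\<lambda>(i, j, k, l). fls_const (fls_const (c (i, j, k, l))) * (yF powi e j * tF powi e l))"
  \<comment> \<open>Only the monomials in \<open>M\<close>, which share the exponents of \<open>x\<close> and \<open>z\<close>, contribute in this degree.\<close>
  have "fls_nth (scalarK (c m) * monom_value m) (int i - int k)
      = (if m \<in> M then f m * xzF n ^ k else 0)" if m: "m \<in> Poly_Mapping.keys r" for m
  proof -
    obtain i' j' k' l' where m': "m = (i', j', k', l')" by (cases m)
    let ?a = "fls_const (fls_const (c m)) * (yF powi e j' * tF powi e l' * xzF n ^ k')"
    have "scalarK (c m) * monom_value m = xK powi (int i' - int k') * fls_const ?a"
      by (simp add: m' scalarK_def flip: fls_const_mult_const)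
    then have "fls_nth (scalarK (c m) * monom_value m) (int i - int k)
        = (if int i - int k = int i' - int k' then ?a else 0)"
      by (simp only: fls_nth_powi_xK)
    moreover have "int i - int k = int i' - int k' \<longleftrightarrow> m \<in> M"
    proof -
      have "i' = 0 \<or> k' = 0" "i = 0 \<or> k = 0"
        using normal m ijkl by (auto simp: m' xz_free_def)
      then have "int i - int k = int i' - int k' \<longleftrightarrow> i' = i \<and> k' = k"
        by auto
      then show ?thesis
        using m by (auto simp: m' M_def)
    qed
    moreover have "?a = f m * xzF n ^ k" if "m \<in> M"
      using that by (simp add: f_def m' M_def)
    ultimately show ?thesis
      by simp
  qed
  then have "fls_nth (ext r) (int i - int k)
      = (\<Sum>m\<in>Poly_Mapping.keys r. if m \<in> M then f m * xzF n ^ k else 0)"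
    by (simp add: ext_def fls_nth_sum c_def)
  also have "\<dots> = (\<Sum>m\<in>M. f m) * xzF n ^ k"
    by (simp add: sum_distrib_right M_def flip: sum.inter_filter)
  finally have 0: "(\<Sum>m\<in>M. f m) = 0"
    using assms(2) by simp
  have "fls_nth (fls_nth (f m) (e j)) (e l) = (if m = (i, j, k, l) then c m else 0)" if "m \<in> M" for m
  proof -
    obtain j' l' where m: "m = (i, j', k, l')"
      using \<open>m \<in> M\<close> by (auto simp: M_def)
    show ?thesis
      unfolding f_def m prod.case fls_nth_powi_yF_tF by (auto simp: e_inj)
  qed
  then have "fls_nth (fls_nth (\<Sum>m\<in>M. f m) (e j)) (e l) = (\<Sum>m\<in>M. if m = (i, j, k, l) then c m else 0)"
    by (simp add: fls_nth_sum)
  also have "\<dots> = c (i, j, k, l)"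
    using ijkl by (simp add: M_def)
  finally show False
    using ijkl 0 by (simp add: c_def in_keys_iff)
qed

lemma ext_eq_0_iff: "ext p = 0 \<longleftrightarrow> Y_equation n dvd p"
proof
  assume "ext p = 0"
  let ?y = "xyzt_monom 0 1 0 0 :: 'e xyzt_poly" and ?t = "xyzt_monom 0 0 0 1 :: 'e xyzt_poly"
  have f: "xyzt_monom 1 0 1 0 - ?y * (?y + ?t ^ n) = Y_equation n"
    by (simp add: Y_equation_def) (simp add: xyzt_simps)
  have "yt_poly (?y * (?y + ?t ^ n))"
    by (intro yt_poly_mult yt_poly_add yt_poly_power yt_poly_monom)
  from normal_form[OF this, of p] obtain r where r: "xz_free r" "Y_equation n dvd (p - r)"
    unfolding f by blast
  then obtain q where "p - r = Y_equation n * q"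
    by (auto elim: dvdE)
  then have "ext (p - r) = ext (Y_equation n) * ext q"
    by (simp only: ext_mult)
  then have "r = 0"
    using r \<open>ext p = 0\<close> by (simp add: normal_form_ext_eq_0 ext_Y_equation)
  then show "Y_equation n dvd p"
    using r by simp
qed (auto simp: ext_Y_equation)

end


section \<open>Coordinate rings as domains\<close>

lemma xyzt_ring_simps [simp]:
  "carrier xyzt_ring = UNIV" "\<zero>\<^bsub>xyzt_ring\<^esub> = 0" "\<one>\<^bsub>xyzt_ring\<^esub> = 1"
  "p \<oplus>\<^bsub>xyzt_ring\<^esub> q = p + q" "p \<otimes>\<^bsub>xyzt_ring\<^esub> q = p * q"
  by (simp_all add: xyzt_ring_def)

lemma xyzt_cring: "cring xyzt_ring"
proof (rule cringI)
  show "abelian_group xyzt_ring"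
  proof (rule abelian_groupI)
    show "\<exists>q\<in>carrier xyzt_ring. q \<oplus>\<^bsub>xyzt_ring\<^esub> p = \<zero>\<^bsub>xyzt_ring\<^esub>" for p :: "('e::comm_monoid_add) xyzt_poly"
      by (rule bexI[of _ "- p"]) simp_all
  qed (simp_all add: algebra_simps)
  show "comm_monoid xyzt_ring"
    by (rule comm_monoidI) (simp_all add: algebra_simps)
qed (simp_all add: algebra_simps)

lemma Y_ideal: "ideal (PIdl\<^bsub>xyzt_ring\<^esub> (Y_equation n)) xyzt_ring"
  by (rule cring.cgenideal_ideal[OF xyzt_cring]) simp

lemma residue_class_eq_Collect: "residue_class n p = {q. Y_equation n dvd q - p}"
proof -
  have "q \<in> residue_class n p \<longleftrightarrow> (\<exists>r. q = r * Y_equation n + p)" for q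
    by (auto simp: residue_class_def a_r_coset_def' cgenideal_def)
  then show ?thesis
    by (auto simp: dvd_def algebra_simps)
qed

lemma residue_class_eq_iff: "residue_class n p = residue_class n q \<longleftrightarrow> Y_equation n dvd p - q"
proof
  assume "residue_class n p = residue_class n q"
  moreover have "p \<in> residue_class n p"
    by (simp add: residue_class_eq_Collect)
  ultimately show "Y_equation n dvd p - q"
    by (simp add: residue_class_eq_Collect)
next
  assume *: "Y_equation n dvd p - q"
  have "Y_equation n dvd r - p \<longleftrightarrow> Y_equation n dvd r - q" for r
    using dvd_add_left_iff[OF *, of "r - p"] by simp
  then show "residue_class n p = residue_class n q"
    by (simp add: residue_class_eq_Collect)
qed

lemma residue_class_hom: "residue_class n \<in> ring_hom xyzt_ring (coord_ring n)"
  using ideal.rcos_ring_hom[OF Y_ideal] by (simp add: coord_ring_def residue_class_def[abs_def])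

lemma residue_class_simps:
  "residue_class n (p + q) = residue_class n p \<oplus>\<^bsub>coord_ring n\<^esub> residue_class n q"
  "residue_class n (p * q) = residue_class n p \<otimes>\<^bsub>coord_ring n\<^esub> residue_class n q"
  "residue_class n 1 = \<one>\<^bsub>coord_ring n\<^esub>"
  using ring_hom_add[OF residue_class_hom] ring_hom_mult[OF residue_class_hom]
    ring_hom_one[OF residue_class_hom] by force+

lemma carrier_coord_ring: "carrier (coord_ring n) = range (residue_class n)"
  by (auto simp: coord_ring_def FactRing_def A_RCOSETS_def' residue_class_def)

lemma residue_class_carrier [simp]: "residue_class n p \<in> carrier (coord_ring n)"
  by (simp add: carrier_coord_ring)

lemma coord_ring_cring: "cring (coord_ring n)"
  unfolding coord_ring_def by (rule ideal.quotient_is_cring[OF Y_ideal xyzt_cring])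

lemma residue_class_zero: "residue_class n 0 = \<zero>\<^bsub>coord_ring n\<^esub>"
proof -
  interpret cring "coord_ring n" by (rule coord_ring_cring)
  have "residue_class n 0 \<oplus>\<^bsub>coord_ring n\<^esub> residue_class n 0 = residue_class n 0"
    by (simp flip: residue_class_simps)
  then show ?thesis by simp
qed

lemma residue_class_uminus: "residue_class n (- p) = \<ominus>\<^bsub>coord_ring n\<^esub> residue_class n p"
proof -
  interpret cring "coord_ring n" by (rule coord_ring_cring)
  have "residue_class n (- p) \<oplus>\<^bsub>coord_ring n\<^esub> residue_class n p = \<zero>\<^bsub>coord_ring n\<^esub>"
    by (simp flip: residue_class_simps residue_class_zero)
  then show ?thesis by (simp add: minus_equality)
qed


section \<open>The fraction field of a subring of a field\<close>

text \<open>
  Given an embedding \<open>val\<close> of \<open>R\<close> into a field, a class of fractions of \<open>R\<close> is determined by its quotient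
  of values, and the operations of \<open>fraction_field R\<close> become those of the field.
\<close>
locale embedded_domain = domain R for R (structure) +
  fixes val :: "'a \<Rightarrow> 'k::field"
  assumes val_add: "a \<in> carrier R \<Longrightarrow> b \<in> carrier R \<Longrightarrow> val (a \<oplus> b) = val a + val b"
    and val_mult: "a \<in> carrier R \<Longrightarrow> b \<in> carrier R \<Longrightarrow> val (a \<otimes> b) = val a * val b"
    and val_one: "val \<one> = 1"
    and val_inj: "inj_on val (carrier R)"
begin

lemma val_zero: "val \<zero> = 0"
proof -
  have "val \<zero> + val \<zero> = val \<zero> + 0"
    using val_add[of \<zero> \<zero>] by (simp only: l_zero zero_closed add_0_right)
  then show ?thesis by (simp only: add_left_cancel)
qed

lemma val_eq_0_iff: "a \<in> carrier R \<Longrightarrow> val a = 0 \<longleftrightarrow> a = \<zero>"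
  using inj_onD[OF val_inj, of a \<zero>] val_zero by auto

lemma val_uminus: "a \<in> carrier R \<Longrightarrow> val (\<ominus> a) = - val a"
  using val_add[of a "\<ominus> a"] by (simp add: r_neg val_zero eq_neg_iff_add_eq_0 add.commute)

definition fractions :: "'k set" where
  "fractions = {val a / val b | a b. a \<in> carrier R \<and> b \<in> carrier R - {\<zero>}}"

definition fraction :: "'k \<Rightarrow> ('a \<times> 'a) set" where
  "fraction q = {(c, d). c \<in> carrier R \<and> d \<in> carrier R - {\<zero>} \<and> val c = q * val d}"

lemma frac_class_eq_fraction:
  assumes "a \<in> carrier R" "b \<in> carrier R - {\<zero>}"
  shows "frac_class R a b = fraction (val a / val b)"
proof -
  have "a \<otimes> d = c \<otimes> b \<longleftrightarrow> val c = val a / val b * val d"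
    if "c \<in> carrier R" "d \<in> carrier R" for c d
  proof -
    have "a \<otimes> d = c \<otimes> b \<longleftrightarrow> val (a \<otimes> d) = val (c \<otimes> b)"
      using assms that inj_on_eq_iff[OF val_inj] by simp
    also have "\<dots> \<longleftrightarrow> val c = val a / val b * val d"
      using assms that val_eq_0_iff[of b] by (auto simp: val_mult field_simps)
    finally show ?thesis .
  qed
  then show ?thesis
    by (auto simp: frac_class_def fraction_def)
qed

lemma fractionsE:
  assumes "q \<in> fractions"
  obtains a b where "(a, b) \<in> fraction q"
proof -
  obtain a b where "q = val a / val b" "a \<in> carrier R" "b \<in> carrier R - {\<zero>}"
    using assms by (auto simp: fractions_def)
  then have "(a, b) \<in> fraction q"
    by (auto simp: fraction_def val_eq_0_iff)
  then show ?thesis by (rule that)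
qed

lemma in_fractionD:
  assumes "(a, b) \<in> fraction q"
  shows "a \<in> carrier R" "b \<in> carrier R" "b \<noteq> \<zero>" "val b \<noteq> 0" "q = val a / val b"
  using assms by (auto simp: fraction_def val_eq_0_iff)

lemma fractionsI: "a \<in> carrier R \<Longrightarrow> b \<in> carrier R \<Longrightarrow> b \<noteq> \<zero> \<Longrightarrow> val a / val b \<in> fractions"
  unfolding fractions_def by blast

lemma val_in_fractions: "a \<in> carrier R \<Longrightarrow> val a \<in> fractions"
  using fractionsI[of a \<one>] one_not_zero by (simp add: val_one)

lemma fractions_add: "q \<in> fractions \<Longrightarrow> r \<in> fractions \<Longrightarrow> q + r \<in> fractions"
proof (elim fractionsE)
  fix a b c d assume "(a, b) \<in> fraction q" "(c, d) \<in> fraction r"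
  note * = in_fractionD[OF this(1)] in_fractionD[OF this(2)]
  then have "val (a \<otimes> d \<oplus> c \<otimes> b) / val (b \<otimes> d) \<in> fractions"
    by (intro fractionsI) (auto simp: integral_iff)
  then show "q + r \<in> fractions"
    using * by (simp add: val_add val_mult add_frac_eq)
qed

lemma fractions_mult: "q \<in> fractions \<Longrightarrow> r \<in> fractions \<Longrightarrow> q * r \<in> fractions"
proof (elim fractionsE)
  fix a b c d assume "(a, b) \<in> fraction q" "(c, d) \<in> fraction r"
  note * = in_fractionD[OF this(1)] in_fractionD[OF this(2)]
  then have "val (a \<otimes> c) / val (b \<otimes> d) \<in> fractions"
    by (intro fractionsI) (auto simp: integral_iff)
  then show "q * r \<in> fractions"
    using * by (simp add: val_mult)
qed

lemma fractions_uminus: "q \<in> fractions \<Longrightarrow> - q \<in> fractions"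
  using fractions_mult[OF val_in_fractions[of "\<ominus> \<one>"]] by (simp add: val_uminus val_one)

lemma fraction_inj: "inj_on fraction fractions"
  by (rule inj_onI) (metis fractionsE in_fractionD(5))

lemma fraction_field_carrier: "carrier (fraction_field R) = fraction ` fractions"
  unfolding fraction_field_def fractions_def using frac_class_eq_fraction by (auto; blast)

lemma fraction_field_one: "\<one>\<^bsub>fraction_field R\<^esub> = fraction 1"
  using one_not_zero by (simp add: fraction_field_def frac_class_eq_fraction val_one)

lemma fraction_field_zero: "\<zero>\<^bsub>fraction_field R\<^esub> = fraction 0"
  using one_not_zero by (simp add: fraction_field_def frac_class_eq_fraction val_zero)

text \<open>
  The operations of \<open>fraction_field\<close> are unions over all representatives, which collapse as soon as
  all representatives give the same class; representatives exist because the classes are nonempty.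
\<close>
lemma UN_fraction_eq:
  assumes "q \<in> fractions" "r \<in> fractions"
    and "\<And>a b c d. (a, b) \<in> fraction q \<Longrightarrow> (c, d) \<in> fraction r \<Longrightarrow> f a b c d = S"
  shows "(\<Union>(a, b)\<in>fraction q. \<Union>(c, d)\<in>fraction r. f a b c d) = S"
proof -
  obtain a b c d where "(a, b) \<in> fraction q" "(c, d) \<in> fraction r"
    using assms(1,2) by (metis fractionsE)
  then show ?thesis
    using assms(3) by fast
qed

lemma fraction_mult:
  assumes "q \<in> fractions" "r \<in> fractions"
  shows "fraction (q * r) = fraction q \<otimes>\<^bsub>fraction_field R\<^esub> fraction r"
proof -
  have "frac_class R (a \<otimes> c) (b \<otimes> d) = fraction (q * r)"
    if "(a, b) \<in> fraction q" "(c, d) \<in> fraction r" for a b c d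
    using in_fractionD[OF that(1)] in_fractionD[OF that(2)]
    by (simp add: frac_class_eq_fraction integral_iff val_mult)
  from UN_fraction_eq[OF assms this] show ?thesis
    by (simp add: fraction_field_def)
qed

lemma fraction_add:
  assumes "q \<in> fractions" "r \<in> fractions"
  shows "fraction (q + r) = fraction q \<oplus>\<^bsub>fraction_field R\<^esub> fraction r"
proof -
  have "frac_class R (a \<otimes> d \<oplus> c \<otimes> b) (b \<otimes> d) = fraction (q + r)"
    if "(a, b) \<in> fraction q" "(c, d) \<in> fraction r" for a b c d
    using in_fractionD[OF that(1)] in_fractionD[OF that(2)]
    by (simp add: frac_class_eq_fraction integral_iff val_mult val_add add_frac_eq)
  from UN_fraction_eq[OF assms this] show ?thesis
    by (simp add: fraction_field_def)
qed

lemma fraction_uminus: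
  assumes "q \<in> fractions"
  shows "fraction (- q) = \<ominus>\<^bsub>fraction_field R\<^esub> fraction q"
proof -
  have eq: "fraction q \<oplus>\<^bsub>fraction_field R\<^esub> fraction r = \<zero>\<^bsub>fraction_field R\<^esub> \<longleftrightarrow> r = - q"
    "fraction r \<oplus>\<^bsub>fraction_field R\<^esub> fraction q = \<zero>\<^bsub>fraction_field R\<^esub> \<longleftrightarrow> r = - q"
    if "r \<in> fractions" for r
  proof -
    have "fraction q \<oplus>\<^bsub>fraction_field R\<^esub> fraction r = fraction (q + r)"
      "fraction r \<oplus>\<^bsub>fraction_field R\<^esub> fraction q = fraction (q + r)"
      using that assms by (simp_all add: add.commute flip: fraction_add)
    moreover have "fraction (q + r) = fraction 0 \<longleftrightarrow> q + r = 0"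
      using that assms inj_on_eq_iff[OF fraction_inj] fractions_add val_in_fractions[of \<zero>]
      by (simp add: val_zero)
    moreover have "q + r = 0 \<longleftrightarrow> r = - q"
      by (auto simp: eq_neg_iff_add_eq_0 add.commute)
    ultimately show "fraction q \<oplus>\<^bsub>fraction_field R\<^esub> fraction r = \<zero>\<^bsub>fraction_field R\<^esub> \<longleftrightarrow> r = - q"
      "fraction r \<oplus>\<^bsub>fraction_field R\<^esub> fraction q = \<zero>\<^bsub>fraction_field R\<^esub> \<longleftrightarrow> r = - q"
      by (simp_all add: fraction_field_zero)
  qed
  show ?thesis
    unfolding a_inv_def m_inv_def
    by (rule the_equality[symmetric])
       (use assms eq in \<open>auto simp: fraction_field_carrier fractions_uminus\<close>)
qed

end


section \<open>Values of elements of the coordinate rings\<close>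

context exponent_embedding
begin

definition val :: "'e xyzt_poly set \<Rightarrow> xyt_field" where
  "val A = ext (SOME p. residue_class n p = A)"

lemma residue_class_eq_iff_ext: "residue_class n p = residue_class n q \<longleftrightarrow> ext p = ext q"
  using ext_eq_0_iff[of "p - q"] by (simp add: residue_class_eq_iff)

lemma val_residue_class [simp]: "val (residue_class n p) = ext p"
proof -
  have "residue_class n (SOME q. residue_class n q = residue_class n p) = residue_class n p"
    by (rule someI) (rule refl)
  then show ?thesis
    by (simp add: val_def residue_class_eq_iff_ext)
qed

sublocale coord: embedded_domain "coord_ring n" val
proof (intro embedded_domain.intro embedded_domain_axioms.intro)
  interpret cring "coord_ring n :: 'e xyzt_poly set ring" by (rule coord_ring_cring)
  show "domain (coord_ring n :: 'e xyzt_poly set ring)"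
  proof unfold_locales
    show "\<one>\<^bsub>coord_ring n\<^esub> \<noteq> \<zero>\<^bsub>coord_ring n :: 'e xyzt_poly set ring\<^esub>"
      by (simp add: residue_class_eq_iff_ext flip: residue_class_simps residue_class_zero)
    show "a = \<zero>\<^bsub>coord_ring n\<^esub> \<or> b = \<zero>\<^bsub>coord_ring n\<^esub>"
      if ab: "a \<otimes>\<^bsub>coord_ring n\<^esub> b = \<zero>\<^bsub>coord_ring n\<^esub>" "a \<in> carrier (coord_ring n)" "b \<in> carrier (coord_ring n)"
      for a b :: "'e xyzt_poly set"
    proof -
      obtain p q where pq: "a = residue_class n p" "b = residue_class n q"
        using ab(2,3) unfolding carrier_coord_ring by blast
      then have "residue_class n (p * q) = residue_class n 0"
        using ab(1) by (simp only: residue_class_simps residue_class_zero)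
      then have "ext p = 0 \<or> ext q = 0"
        by (simp add: residue_class_eq_iff_ext)
      then show ?thesis
        unfolding pq residue_class_zero[symmetric] residue_class_eq_iff_ext by simp
    qed
  qed
  show "inj_on val (carrier (coord_ring n))"
    by (auto simp: carrier_coord_ring inj_on_def residue_class_eq_iff_ext)
  show "val \<one>\<^bsub>coord_ring n\<^esub> = 1"
    unfolding residue_class_simps(3)[symmetric] val_residue_class by (rule ext_one)
  show "val (a \<oplus>\<^bsub>coord_ring n\<^esub> b) = val a + val b" "val (a \<otimes>\<^bsub>coord_ring n\<^esub> b) = val a * val b"
    if ab: "a \<in> carrier (coord_ring n)" "b \<in> carrier (coord_ring n)" for a b :: "'e xyzt_poly set"
  proof -
    obtain p q where pq: "a = residue_class n p" "b = residue_class n q"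
      using ab unfolding carrier_coord_ring by blast
    show "val (a \<oplus>\<^bsub>coord_ring n\<^esub> b) = val a + val b" "val (a \<otimes>\<^bsub>coord_ring n\<^esub> b) = val a * val b"
      unfolding pq residue_class_simps(1,2)[symmetric] val_residue_class by simp_all
  qed
qed

end


section \<open>The dual cone\<close>

text \<open>
  The condition \<open>vtrop_rel v v\<close> says that \<open>v\<close> is a point of \<open>vtrop\<close>, that is \<open>0 \<le> i\<close>; with \<open>i < 0\<close> the term
  \<open>i * min b (n c)\<close> would be convex instead.
\<close>
lemma chart_pairing_concave:
  assumes "vtrop_rel v v"
  shows "chart_pairing n u v + chart_pairing n u' v \<le> chart_pairing n (u + u') v"
proof -
  obtain a b c a' b' c' where u: "u = (a, b, c)" "u' = (a', b', c')"
    by (metis prod.exhaust)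
  show ?thesis
  proof (cases v)
    case (Chart1 i j k)
    then show ?thesis by (simp add: u algebra_simps)
  next
    case (Chart2 i j k)
    have "min b (n * c) + min b' (n * c') \<le> min (b + b') (n * (c + c'))"
      by (simp add: min_def algebra_simps)
    then have "i * (min b (n * c) + min b' (n * c')) \<le> i * min (b + b') (n * (c + c'))"
      using assms Chart2 by (simp add: mult_left_mono)
    then show ?thesis by (simp add: u Chart2 algebra_simps)
  qed
qed

lemma chart_pairing_scaleR:
  assumes "0 \<le> r"
  shows "chart_pairing n (r *\<^sub>R u) v = r * chart_pairing n u v"
proof -
  obtain a b c where u: "u = (a, b, c)" by (cases u)
  have "min (r * b) (n * (r * c)) = r * min b (n * c)"
    using assms min_mult_distrib_left[of r b "n * c"] by (simp add: mult.left_commute)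
  then show ?thesis
    by (cases v) (simp_all add: u algebra_simps)
qed

text \<open>
  By concavity and homogeneity the points that pair nonnegatively with \<open>v\<close> form a convex cone.
\<close>
lemma in_dual_cone_hull_iff:
  assumes "vtrop_rel v v"
  shows "abs_vtrop v \<in> dual_cone n (convex_cone hull S) \<longleftrightarrow> (\<forall>u\<in>S. 0 \<le> chart_pairing n u v)"
proof -
  have pairing: "trop_pairing n u (abs_vtrop v) = chart_pairing n u v" for u
    by (rule trop_pairing.abs_eq) (fact assms)
  have "convex_cone {u. 0 \<le> chart_pairing n u v}"
    unfolding convex_cone_iff
  proof (intro conjI allI ballI impI)
    show "0 \<in> {u. 0 \<le> chart_pairing n u v}"
      using chart_pairing_scaleR[of 0 n 0 v] by simp
    show "u + u' \<in> {u. 0 \<le> chart_pairing n u v}"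
      if "u \<in> {u. 0 \<le> chart_pairing n u v}" "u' \<in> {u. 0 \<le> chart_pairing n u v}" for u u'
      using that chart_pairing_concave[OF assms, of n u u'] by simp
    show "r *\<^sub>R u \<in> {u. 0 \<le> chart_pairing n u v}"
      if "u \<in> {u. 0 \<le> chart_pairing n u v}" "0 \<le> r" for u r
      using that by (simp add: chart_pairing_scaleR)
  qed
  then have "S \<subseteq> {u. 0 \<le> chart_pairing n u v} \<longleftrightarrow> convex_cone hull S \<subseteq> {u. 0 \<le> chart_pairing n u v}"
    by (metis hull_minimal hull_subset subset_trans)
  then show ?thesis
    by (auto simp: dual_cone_def pairing)
qed

lemma in_dual_cone_tau1:
  assumes "0 \<le> i"
  shows "abs_vtrop (Chart1 i j k) \<in> dual_cone n (tau1 n) \<longleftrightarrow> 0 \<le> j \<and> 0 \<le> k"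
    and "abs_vtrop (Chart2 i j k) \<in> dual_cone n (tau1 n) \<longleftrightarrow> 0 \<le> i + j \<and> 0 \<le> k"
proof -
  \<comment> \<open>On both charts the pairing with the generator \<open>(n, n, 1)\<close> is \<open>i n + j n + k\<close>.\<close>
  have "0 \<le> i * real n + j * real n + k" if "0 \<le> j" "0 \<le> k"
    using that assms by simp
  then show "abs_vtrop (Chart1 i j k) \<in> dual_cone n (tau1 n) \<longleftrightarrow> 0 \<le> j \<and> 0 \<le> k"
    using assms by (auto simp: tau1_def in_dual_cone_hull_iff)
  have "0 \<le> i * real n + j * real n + k" if "0 \<le> i + j" "0 \<le> k"
    using that mult_nonneg_nonneg[of "i + j" "real n"] by (simp add: distrib_right)
  then show "abs_vtrop (Chart2 i j k) \<in> dual_cone n (tau1 n) \<longleftrightarrow> 0 \<le> i + j \<and> 0 \<le> k"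
    using assms by (auto simp: tau1_def in_dual_cone_hull_iff)
qed


section \<open>The patch ring as the image of a polynomial ring\<close>

text \<open>
  The third variable plays the role of \<open>u = z / y\<close>, so \<open>x^i y^j u^k t^l\<close> becomes \<open>x^i y^(j - k) z^k t^l\<close>.
\<close>
fun patch_monom :: "nat \<times> nat \<times> nat \<times> nat \<Rightarrow> int xyzt_poly" where
  "patch_monom (i, j, k, l) = xyzt_monom i (int j - int k) k (int l)"

interpretation patch: monoid_algebra_hom xyzt_const patch_monom
proof
  fix m m' :: "nat \<times> nat \<times> nat \<times> nat"
  obtain i j k l i' j' k' l' where "m = (i, j, k, l)" "m' = (i', j', k', l')"
    by (metis prod.exhaust)
  then show "patch_monom (m + m') = patch_monom m * patch_monom m'"
    by (simp add: xyzt_simps add_diff_add)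
next
  show "patch_monom 0 = 1"
    by (simp add: zero_prod_def xyzt_monom_def flip: single_one)
qed (simp_all add: xyzt_const_def single_add mult_single)

abbreviation patch_class :: "nat \<Rightarrow> nat xyzt_poly \<Rightarrow> int xyzt_poly set" where
  "patch_class n p \<equiv> residue_class n (patch.ext p)"

lemma patch_ext_const: "patch.ext (xyzt_const c) = xyzt_const c"
  by (simp add: xyzt_const_def patch.g_zero)

lemma patch_ext_monom: "patch.ext (xyzt_monom i j k l) = xyzt_monom i (int j - int k) k (int l)"
  by (simp add: xyzt_monom_def[of i j] xyzt_const_def patch.\<kappa>_one)

lemmas patch_class_simps =
  patch.ext_add patch.ext_mult patch.ext_one patch.ext_uminus residue_class_simps residue_class_uminus

lemma theta_functions_in_dual_cone_tau1:
  "theta_functions_in n (dual_cone n (tau1 n))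
     = {patch_class n (xyzt_monom i j k l) | i j k l. i = 0 \<or> k = 0}" (is "?T = ?P")
proof
  show "?T \<subseteq> ?P"
  proof
    fix A assume "A \<in> ?T"
    then consider i j l where "A = monom_class n i j 0 l" "0 \<le> j" "0 \<le> l"
      | i j l where "A = monom_class n 0 j i l" "0 \<le> int i + j" "0 \<le> l"
      by (auto simp: theta_functions_in_def in_dual_cone_tau1)
    then show "A \<in> ?P"
    proof cases
      case (1 i j l)
      then have "A = patch_class n (xyzt_monom i (nat j) 0 (nat l))"
        by (simp add: monom_class_def patch_ext_monom)
      then show ?thesis by blast
    next
      case (2 i j l)
      then have "A = patch_class n (xyzt_monom 0 (nat (int i + j)) i (nat l))"
        by (simp add: monom_class_def patch_ext_monom)
      then show ?thesis by blast
    qed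
  qed
  show "?P \<subseteq> ?T"
  proof clarify
    fix i j k l :: nat assume "i = 0 \<or> k = 0"
    moreover have "monom_class n i (int j) 0 (int l) \<in> ?T"
    proof -
      have "abs_vtrop (Chart1 (real i) (of_int (int j)) (of_int (int l))) \<in> dual_cone n (tau1 n)"
        by (simp add: in_dual_cone_tau1)
      then show ?thesis unfolding theta_functions_in_def by blast
    qed
    moreover have "monom_class n 0 (int j - int k) k (int l) \<in> ?T"
    proof -
      have "abs_vtrop (Chart2 (real k) (of_int (int j - int k)) (of_int (int l))) \<in> dual_cone n (tau1 n)"
        by (simp add: in_dual_cone_tau1)
      then show ?thesis unfolding theta_functions_in_def by blast
    qed
    ultimately show "patch_class n (xyzt_monom i j k l) \<in> ?T"
      by (auto simp: patch_ext_monom monom_class_def)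
  qed
qed

text \<open>
  In \<open>C[U]\<close> the variable \<open>y\<close> is invertible, and dividing the equation of \<open>Y\<close> by it gives \<open>x u = y + t^n\<close>.
\<close>
lemma patch_class_relation:
  "patch_class n (xyzt_monom 1 0 1 0 - (xyzt_monom 0 1 0 0 + xyzt_monom 0 0 0 1 ^ n))
     = \<zero>\<^bsub>CU n\<^esub>"
proof -
  let ?y = "xyzt_monom 0 1 0 0 :: int xyzt_poly" and ?t = "xyzt_monom 0 0 0 1 :: int xyzt_poly"
  have "patch.ext (xyzt_monom 1 0 1 0 - (xyzt_monom 0 1 0 0 + xyzt_monom 0 0 0 1 ^ n))
      = xyzt_monom 1 (- 1) 1 0 - (?y + ?t ^ n)"
    by (simp add: patch_ext_monom)
  also have "\<dots> = Y_equation n * xyzt_monom 0 (- 1) 0 0"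
  proof -
    have "?y * xyzt_monom 0 (- 1) 0 0 = 1"
      by (simp add: xyzt_simps flip: single_one)
    moreover have "?y * (?y + ?t ^ n) * xyzt_monom 0 (- 1) 0 0
        = (?y * xyzt_monom 0 (- 1) 0 0) * (?y + ?t ^ n)"
      by (simp only: mult_ac)
    moreover have "xyzt_monom 1 0 0 0 * xyzt_monom 0 0 1 0 * xyzt_monom 0 (- 1) 0 0
        = xyzt_monom 1 (- 1 :: int) 1 0"
      by (simp add: xyzt_simps)
    ultimately show ?thesis
      by (simp only: Y_equation_def left_diff_distrib mult_1)
  qed
  finally show ?thesis
    by (simp add: residue_class_eq_iff flip: residue_class_zero)
qed

text \<open>
  The theta functions in the dual cone are the classes of the monomials of \<open>xz_free\<close> polynomials, so
  their span consists of the classes of all \<open>xz_free\<close> polynomials. By \<open>normal_form\<close> these are all classes.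
\<close>
lemma theta_span_dual_cone_tau1:
  "theta_span n (dual_cone n (tau1 n)) = range (patch_class n)"
proof -
  interpret CU: cring "CU n" by (rule coord_ring_cring)
  let ?T = "theta_functions_in n (dual_cone n (tau1 n))"
  have span: "theta_span n (dual_cone n (tau1 n)) = (\<Union>Us\<in>{Us. set Us \<subseteq> ?T}. CU.Span (scalars n) Us)"
    by (simp add: theta_span_def linear_span_def)
  note CU.Span.simps [simp del]
  have Span_Nil: "CU.Span (scalars n) [] = {\<zero>\<^bsub>CU n\<^esub>}"
    by (simp add: CU.Span.simps)
  have Span_Cons: "A \<in> CU.Span (scalars n) (u # Us) \<longleftrightarrow>
      (\<exists>c. \<exists>B\<in>CU.Span (scalars n) Us. A = residue_class n (xyzt_const c) \<otimes>\<^bsub>CU n\<^esub> u \<oplus>\<^bsub>CU n\<^esub> B)" for A u Us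
    by (simp add: CU.Span.simps CU.line_extension_mem_iff scalars_def)
  have span_subset: "CU.Span (scalars n) Us \<subseteq> range (patch_class n)" if "set Us \<subseteq> ?T" for Us
    using that
  proof (induction Us)
    case Nil
    show ?case
      using rangeI[of "patch_class n" 0] by (simp add: Span_Nil residue_class_zero)
  next
    case (Cons u Us)
    then have Us: "CU.Span (scalars n) Us \<subseteq> range (patch_class n)"
      by simp
    obtain m where u: "u = patch_class n m"
      using Cons.prems by (auto simp: theta_functions_in_dual_cone_tau1)
    show ?case
    proof
      fix A assume "A \<in> CU.Span (scalars n) (u # Us)"
      then obtain c B where A: "B \<in> CU.Span (scalars n) Us"
        "A = residue_class n (xyzt_const c) \<otimes>\<^bsub>CU n\<^esub> u \<oplus>\<^bsub>CU n\<^esub> B"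
        unfolding Span_Cons by blast
      moreover obtain p where "B = patch_class n p"
        using A(1) Us by blast
      ultimately have "A = patch_class n (xyzt_const c * m + p)"
        by (simp only: u patch_class_simps patch_ext_const)
      then show "A \<in> range (patch_class n)" by blast
    qed
  qed
  have in_span: "\<exists>Us. set Us \<subseteq> ?T \<and> patch_class n r \<in> CU.Span (scalars n) Us" if "xz_free r" for r
  proof -
    have "\<exists>Us. set Us \<subseteq> ?T \<and>
        patch_class n (\<Sum>m\<in>M. Poly_Mapping.single m (Poly_Mapping.lookup r m)) \<in> CU.Span (scalars n) Us"
      if "finite M" "M \<subseteq> Poly_Mapping.keys r" for M
      using that
    proof (induction M)
      case empty
      show ?case
        by (rule exI[of _ "[]"]) (simp add: Span_Nil residue_class_zero)
    next
      case (insert m M)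
      then obtain Us where Us: "set Us \<subseteq> ?T"
        "patch_class n (\<Sum>m\<in>M. Poly_Mapping.single m (Poly_Mapping.lookup r m)) \<in> CU.Span (scalars n) Us"
        by auto
      obtain i j k l where m: "m = (i, j, k, l)" by (cases m)
      have "i = 0 \<or> k = 0"
        using insert.prems \<open>xz_free r\<close> by (auto simp: xz_free_def m)
      then have "patch_class n (xyzt_monom i j k l) \<in> ?T"
        unfolding theta_functions_in_dual_cone_tau1 by blast
      moreover have "Poly_Mapping.single m (Poly_Mapping.lookup r m)
          = xyzt_const (Poly_Mapping.lookup r m) * xyzt_monom i j k l"
        by (simp add: xyzt_simps m)
      then have "patch_class n (\<Sum>m\<in>insert m M. Poly_Mapping.single m (Poly_Mapping.lookup r m))
          = residue_class n (xyzt_const (Poly_Mapping.lookup r m)) \<otimes>\<^bsub>CU n\<^esub> patch_class n (xyzt_monom i j k l)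
            \<oplus>\<^bsub>CU n\<^esub> patch_class n (\<Sum>m\<in>M. Poly_Mapping.single m (Poly_Mapping.lookup r m))"
        by (simp only: sum.insert[OF insert.hyps] patch_class_simps patch_ext_const)
      then have "patch_class n (\<Sum>m\<in>insert m M. Poly_Mapping.single m (Poly_Mapping.lookup r m))
          \<in> CU.Span (scalars n) (patch_class n (xyzt_monom i j k l) # Us)"
        unfolding Span_Cons using Us(2) by blast
      ultimately show ?case
        using Us(1) by (intro exI[of _ "patch_class n (xyzt_monom i j k l) # Us"]) simp
    qed
    from this[OF finite_keys order_refl] show ?thesis
      unfolding sum_single_lookup .
  qed
  have reduce: "\<exists>r. xz_free r \<and> patch_class n p = patch_class n r" for p
  proof -
    have "yt_poly (xyzt_monom 0 1 0 0 + xyzt_monom 0 0 0 1 ^ n :: nat xyzt_poly)"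
      by (intro yt_poly_add yt_poly_power yt_poly_monom)
    from normal_form[OF this, of p] obtain r q where r: "xz_free r"
      "p - r = (xyzt_monom 1 0 1 0 - (xyzt_monom 0 1 0 0 + xyzt_monom 0 0 0 1 ^ n)) * q"
      unfolding dvd_def by blast
    have "patch_class n (p - r) = \<zero>\<^bsub>CU n\<^esub>"
      unfolding r(2) patch.ext_mult residue_class_simps patch_class_relation
      by (simp add: CU.l_null)
    then have "Y_equation n dvd patch.ext p - patch.ext r"
      by (simp add: residue_class_eq_iff flip: residue_class_zero)
    then show ?thesis
      using r(1) by (auto simp: residue_class_eq_iff)
  qed
  show ?thesis
    unfolding span
  proof (intro equalityI UN_least subsetI)
    fix A assume "A \<in> range (patch_class n)"
    then obtain r where "xz_free r" "A = patch_class n r"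
      using reduce by blast
    then show "A \<in> (\<Union>Us\<in>{Us. set Us \<subseteq> ?T}. CU.Span (scalars n) Us)"
      using in_span[of r] by blast
  qed (use span_subset in blast)
qed


section \<open>The blowup patch\<close>

interpretation U: exponent_embedding "\<lambda>j :: int. j" n for n
  by unfold_locales simp_all

interpretation Y: exponent_embedding int n for n
  by unfold_locales simp_all

definition patch_value :: "nat \<Rightarrow> nat xyzt_poly \<Rightarrow> xyt_field" where
  "patch_value n p = U.ext n (patch.ext p)"

lemma patch_value_simps:
  "patch_value n (p + q) = patch_value n p + patch_value n q"
  "patch_value n (p * q) = patch_value n p * patch_value n q"
  "patch_value n 1 = 1" "patch_value n 0 = 0" "patch_value n (- p) = - patch_value n p"
  "patch_value n (xyzt_const c) = scalarK c"
  by (simp_all add: patch_value_def patch_ext_const)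

lemma Y_ext_y_nonzero: "Y.ext n (xyzt_monom 0 k 0 0) \<noteq> 0"
  by (simp add: power_int_not_zero fls_const_nonzero)

lemma patch_value_monom:
  "patch_value n (xyzt_monom i j k l) = Y.ext n (xyzt_monom i j k l) / Y.ext n (xyzt_monom 0 k 0 0)"
proof -
  have "yF powi (int j - int k) * yF powi int k = yF powi int j"
    using power_int_add[of yF "int j - int k" "int k"] by (simp del: power_int_of_nat)
  moreover have "(yF powi (int j - int k) * tF powi int l * xzF n ^ k) * yF powi int k
      = (yF powi (int j - int k) * yF powi int k) * tF powi int l * xzF n ^ k"
    by (simp only: mult_ac)
  ultimately have "fls_const (yF powi (int j - int k) * tF powi int l * xzF n ^ k) * fls_const (yF powi int k)
      = fls_const (yF powi int j * tF powi int l * xzF n ^ k)"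
    by (simp only: fls_const_mult_const)
  then have "patch_value n (xyzt_monom i j k l) * Y.ext n (xyzt_monom 0 k 0 0) = Y.ext n (xyzt_monom i j k l)"
    by (simp add: patch_value_def patch_ext_monom mult.assoc)
  then show ?thesis
    using Y_ext_y_nonzero[of n k] by (simp only: eq_divide_eq) simp
qed

lemma residue_class_eq_0_iff_Y: "residue_class n p = \<zero>\<^bsub>CY n\<^esub> \<longleftrightarrow> Y.ext n p = 0"
  using Y.residue_class_eq_iff_ext[of n p 0] by (simp add: residue_class_zero)

lemma patch_value_in_fractions: "patch_value n p \<in> Y.coord.fractions n"
proof (induction p rule: poly_mapping_monomial_induct)
  case zero
  show ?case
    using Y.coord.val_in_fractions[of "residue_class n 0" n] by (simp add: patch_value_simps)
next
  case (single_add m c p)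
  obtain i j k l where m: "m = (i, j, k, l)" by (cases m)
  have "patch_value n (xyzt_monom i j k l) \<in> Y.coord.fractions n"
    using Y.coord.fractionsI[of "residue_class n (xyzt_monom i j k l)" n "residue_class n (xyzt_monom 0 k 0 0)"]
      Y_ext_y_nonzero[of n k]
    unfolding patch_value_monom by (simp add: residue_class_eq_0_iff_Y del: Y.ext_xyzt)
  moreover have "patch_value n (xyzt_const c) \<in> Y.coord.fractions n"
    using Y.coord.val_in_fractions[of "residue_class n (xyzt_const c)" n] by (simp add: patch_value_simps)
  moreover have "Poly_Mapping.single m c = xyzt_const c * xyzt_monom i j k l"
    by (simp add: xyzt_simps m)
  ultimately have "patch_value n (Poly_Mapping.single m c) \<in> Y.coord.fractions n"
    by (simp only: patch_value_simps(2) Y.coord.fractions_mult)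
  then show ?case
    unfolding patch_value_simps using single_add by (rule Y.coord.fractions_add)
qed

text \<open>
  \<open>C[Y]\<close> lies in the patch ring because \<open>z = y u\<close>: the monomial \<open>x^i y^j z^k t^l\<close> is \<open>x^i y^(j + k) u^k t^l\<close>.
\<close>
lemma ext_Y_in_range_patch_value: "Y.ext n p \<in> range (patch_value n)"
proof (induction p rule: poly_mapping_monomial_induct)
  case zero
  show ?case by (rule range_eqI[of _ _ 0]) (simp add: patch_value_simps)
next
  case (single_add m c p)
  obtain i j k l where m: "m = (i, j, k, l)" by (cases m)
  obtain q where q: "Y.ext n p = patch_value n q"
    using single_add by blast
  have "patch_value n (Poly_Mapping.single (i, j + k, k, l) c) = Y.ext n (Poly_Mapping.single m c)"
    by (simp add: patch_value_def m)
  then have "Y.ext n (Poly_Mapping.single m c + p)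
      = patch_value n (Poly_Mapping.single (i, j + k, k, l) c + q)"
    by (simp only: q Y.ext_add patch_value_simps)
  then show ?case by blast
qed

lemma frac_class_CY:
  assumes "Y.ext n q \<noteq> 0"
  shows "frac_class (CY n) (residue_class n p) (residue_class n q) = Y.coord.fraction n (Y.ext n p / Y.ext n q)"
  using assms Y.coord.frac_class_eq_fraction[of "residue_class n p" n "residue_class n q"]
  by (simp add: residue_class_eq_0_iff_Y)

lemma frac_class_CY_one:
  "frac_class (CY n) (residue_class n p) \<one>\<^bsub>CY n\<^esub> = Y.coord.fraction n (Y.ext n p)"
  using frac_class_CY[of n 1 p] by (simp add: residue_class_simps)

text \<open>
  An element of \<open>C[U]\<close> and a fraction of \<open>C[Y]\<close> are identified when they have the same value in the
  field of Laurent series. On the patch ring such a fraction exists by \<open>patch_value_in_fractions\<close>.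
\<close>
definition patch_iso :: "nat \<Rightarrow> int xyzt_poly set \<Rightarrow> (nat xyzt_poly set \<times> nat xyzt_poly set) set" where
  "patch_iso n A = Y.coord.fraction n (U.val n A)"

lemma patch_iso_patch_class: "patch_iso n (patch_class n p) = Y.coord.fraction n (patch_value n p)"
  by (simp add: patch_iso_def patch_value_def)

lemma patch_iso_generators:
  "patch_iso n (residue_class n (xyzt_const c)) = frac_class (CY n) (residue_class n (xyzt_const c)) \<one>\<^bsub>CY n\<^esub>"
  "patch_iso n (monom_class n 1 0 0 0) = frac_class (CY n) (monom_class n 1 0 0 0) \<one>\<^bsub>CY n\<^esub>"
  "patch_iso n (monom_class n 0 1 0 0) = frac_class (CY n) (monom_class n 0 1 0 0) \<one>\<^bsub>CY n\<^esub>"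
  "patch_iso n (monom_class n 0 0 0 1) = frac_class (CY n) (monom_class n 0 0 0 1) \<one>\<^bsub>CY n\<^esub>"
  "patch_iso n (monom_class n 0 (-1) 1 0) = frac_class (CY n) (monom_class n 0 0 1 0) (monom_class n 0 1 0 0)"
proof -
  show "patch_iso n (monom_class n 0 (-1) 1 0) = frac_class (CY n) (monom_class n 0 0 1 0) (monom_class n 0 1 0 0)"
    using patch_iso_patch_class[of n "xyzt_monom 0 0 1 0"] Y_ext_y_nonzero[of n 1]
    by (simp add: monom_class_def frac_class_CY patch_ext_monom patch_value_monom
        del: Y.ext_xyzt(2) One_nat_def)
qed (simp_all add: patch_iso_def monom_class_def frac_class_CY_one)

lemma generate_patch_ring:
  "generate_ring (CU n) (scalars n \<union>
      {monom_class n 1 0 0 0, monom_class n 0 1 0 0, monom_class n 0 (-1) 1 0, monom_class n 0 0 0 1})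
     = range (patch_class n)" (is "generate_ring _ ?G = _")
proof (rule generate_ring_eq_range)
  show "?G \<subseteq> range (patch_class n)"
  proof
    fix A assume "A \<in> ?G"
    then consider c where "A = residue_class n (xyzt_const c)" | "A = monom_class n 1 0 0 0"
      | "A = monom_class n 0 1 0 0" | "A = monom_class n 0 (-1) 1 0" | "A = monom_class n 0 0 0 1"
      by (auto simp: scalars_def)
    then obtain p where "A = patch_class n p"
    proof cases
      case (1 c)
      then show ?thesis using that[of "xyzt_const c"] by (simp add: patch_ext_const)
    next
      case 2
      then show ?thesis using that[of "xyzt_monom 1 0 0 0"] by (simp add: patch_ext_monom monom_class_def)
    next
      case 3
      then show ?thesis using that[of "xyzt_monom 0 1 0 0"] by (simp add: patch_ext_monom monom_class_def)
    next
      case 4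
      then show ?thesis using that[of "xyzt_monom 0 0 1 0"] by (simp add: patch_ext_monom monom_class_def)
    next
      case 5
      then show ?thesis using that[of "xyzt_monom 0 0 0 1"] by (simp add: patch_ext_monom monom_class_def)
    qed
    then show "A \<in> range (patch_class n)" by blast
  qed
qed (simp_all only: patch_class_simps, simp_all add: patch_ext_const patch_ext_monom monom_class_def scalars_def)

text \<open>
  The defining generators of the patch ring are all fractions with denominator \<open>1\<close> together with
  \<open>y / y = 1\<close> and \<open>z / y\<close>. They include the images of \<open>x, y, u, t\<close>, and conversely they lie in the image
  of \<open>C[x, y, u, t]\<close> by \<open>ext_Y_in_range_patch_value\<close>.
\<close>
lemma carrier_blowup_patch_ring:
  "carrier (blowup_patch_ring (CY n) {monom_class n 0 1 0 0, monom_class n 0 0 1 0} (monom_class n 0 1 0 0))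
     = range (\<lambda>p. Y.coord.fraction n (patch_value n p))"
proof -
  let ?h = "\<lambda>p. Y.coord.fraction n (patch_value n p)"
  let ?y = "monom_class n 0 1 0 0" and ?z = "monom_class n 0 0 1 0"
  let ?G = "{frac_class (CY n) r \<one>\<^bsub>CY n\<^esub> | r. r \<in> carrier (CY n)}
    \<union> {frac_class (CY n) g ?y | g. g \<in> {?y, ?z}}"
  have h: "?h p = patch_iso n (patch_class n p)" for p
    by (simp add: patch_iso_patch_class)
  have incl: "frac_class (CY n) A \<one>\<^bsub>CY n\<^esub> \<in> ?G" if "A \<in> carrier (CY n)" for A
    using that by blast
  have mem: "monom_class n i j k l \<in> carrier (CY n)" for i j k l
    by (simp add: monom_class_def)
  have gens: "?h (xyzt_const c) = frac_class (CY n) (residue_class n (xyzt_const c)) \<one>\<^bsub>CY n\<^esub>"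
    "?h (xyzt_monom 1 0 0 0) = frac_class (CY n) (monom_class n 1 0 0 0) \<one>\<^bsub>CY n\<^esub>"
    "?h (xyzt_monom 0 1 0 0) = frac_class (CY n) ?y \<one>\<^bsub>CY n\<^esub>"
    "?h (xyzt_monom 0 0 0 1) = frac_class (CY n) (monom_class n 0 0 0 1) \<one>\<^bsub>CY n\<^esub>"
    "?h (xyzt_monom 0 0 1 0) = frac_class (CY n) ?z ?y" for c
    using patch_iso_generators[of n]
    unfolding h by (simp_all add: patch_ext_const patch_ext_monom monom_class_def)
  have "generate_ring (fraction_field (CY n)) ?G = range ?h"
  proof (rule generate_ring_eq_range)
    show "?G \<subseteq> range ?h"
    proof
      fix A assume "A \<in> ?G"
      then consider p where "A = frac_class (CY n) (residue_class n p) \<one>\<^bsub>CY n\<^esub>"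
        | "A = frac_class (CY n) ?y ?y" | "A = frac_class (CY n) ?z ?y"
        unfolding carrier_coord_ring by blast
      then show "A \<in> range ?h"
      proof cases
        case (1 p)
        obtain q where "Y.ext n p = patch_value n q"
          using ext_Y_in_range_patch_value by blast
        then show ?thesis using 1 by (auto simp: frac_class_CY_one)
      next
        case 2
        then have "A = ?h 1"
          using Y_ext_y_nonzero[of n 1]
          by (simp add: monom_class_def frac_class_CY patch_value_simps del: Y.ext_xyzt One_nat_def)
        then show ?thesis by (rule range_eqI)
      next
        case 3
        then show ?thesis using gens(5) by (metis rangeI)
      qed
    qed
    show "?h (xyzt_const c) \<in> ?G" for c
      unfolding gens by (rule incl) simp
    show "?h (xyzt_monom 1 0 0 0) \<in> ?G" "?h (xyzt_monom 0 1 0 0) \<in> ?G" "?h (xyzt_monom 0 0 0 1) \<in> ?G"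
      unfolding gens by (rule incl mem)+
    show "?h (xyzt_monom 0 0 1 0) \<in> ?G"
      unfolding gens by blast
  qed (simp_all only: patch_value_simps Y.coord.fraction_add Y.coord.fraction_mult
      Y.coord.fraction_uminus Y.coord.fraction_field_one patch_value_in_fractions)
  then show ?thesis
    by (simp add: blowup_patch_ring_def)
qed

theorem proposition4p2:
  fixes n :: nat
  assumes "n \<ge> 1"
  shows
    "domain (CW1 n)
     \<and> carrier (CW1 n) =
         generate_ring (CU n)
           (scalars n \<union>
            {monom_class n 1 0 0 0, monom_class n 0 1 0 0,
             monom_class n 0 (-1) 1 0, monom_class n 0 0 0 1})
     \<and> (\<exists>h \<in> ring_iso (CW1 n)
              (blowup_patch_ring (CY n)
                 {monom_class n 0 1 0 0, monom_class n 0 0 1 0} (monom_class n 0 1 0 0)).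
          (\<forall>c. h (residue_class n (xyzt_const c)) =
                 frac_class (CY n) (residue_class n (xyzt_const c)) \<one>\<^bsub>CY n\<^esub>)
          \<and> h (monom_class n 1 0 0 0) = frac_class (CY n) (monom_class n 1 0 0 0) \<one>\<^bsub>CY n\<^esub>
          \<and> h (monom_class n 0 1 0 0) = frac_class (CY n) (monom_class n 0 1 0 0) \<one>\<^bsub>CY n\<^esub>
          \<and> h (monom_class n 0 0 0 1) = frac_class (CY n) (monom_class n 0 0 0 1) \<one>\<^bsub>CY n\<^esub>
          \<and> h (monom_class n 0 (-1) 1 0) =
              frac_class (CY n) (monom_class n 0 0 1 0) (monom_class n 0 1 0 0))"
proof (intro conjI bexI[of _ "patch_iso n"] allI patch_iso_generators)
  let ?B = "blowup_patch_ring (CY n) {monom_class n 0 1 0 0, monom_class n 0 0 1 0} (monom_class n 0 1 0 0)"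
  have carrier: "carrier (CW1 n) = range (patch_class n)"
    by (simp add: CW1_def theta_span_dual_cone_tau1)
  show generated: "carrier (CW1 n) =
         generate_ring (CU n)
           (scalars n \<union>
            {monom_class n 1 0 0 0, monom_class n 0 1 0 0,
             monom_class n 0 (-1) 1 0, monom_class n 0 0 0 1})"
    by (simp only: carrier generate_patch_ring)
  have "subring (carrier (CW1 n)) (CU n)"
    unfolding generated
    by (rule U.coord.generate_ring_is_subring) (auto simp: scalars_def monom_class_def)
  then have "domain ((CU n)\<lparr>carrier := carrier (CW1 n)\<rparr>)"
    by (rule U.coord.subring_is_domain)
  then show "domain (CW1 n)"
    by (simp add: CW1_def)
  show "patch_iso n \<in> ring_iso (CW1 n) ?B"
    unfolding ring_iso_def
  proof (intro CollectI conjI)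
    have ops: "A \<otimes>\<^bsub>CW1 n\<^esub> A' = A \<otimes>\<^bsub>CU n\<^esub> A'" "A \<oplus>\<^bsub>CW1 n\<^esub> A' = A \<oplus>\<^bsub>CU n\<^esub> A'" "\<one>\<^bsub>CW1 n\<^esub> = \<one>\<^bsub>CU n\<^esub>"
      "B \<otimes>\<^bsub>?B\<^esub> B' = B \<otimes>\<^bsub>fraction_field (CY n)\<^esub> B'" "B \<oplus>\<^bsub>?B\<^esub> B' = B \<oplus>\<^bsub>fraction_field (CY n)\<^esub> B'"
      "\<one>\<^bsub>?B\<^esub> = \<one>\<^bsub>fraction_field (CY n)\<^esub>" for A A' B B'
      by (simp_all add: CW1_def blowup_patch_ring_def)
    show "patch_iso n \<in> ring_hom (CW1 n) ?B"
    proof (rule ring_hom_memI)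
      show "patch_iso n A \<in> carrier ?B" if "A \<in> carrier (CW1 n)" for A
        using that unfolding carrier carrier_blowup_patch_ring by (auto simp: patch_iso_patch_class)
      show "patch_iso n \<one>\<^bsub>CW1 n\<^esub> = \<one>\<^bsub>?B\<^esub>"
        using patch_iso_patch_class[of n 1]
        by (simp only: ops patch.ext_one patch_value_simps residue_class_simps Y.coord.fraction_field_one)
      fix A A' assume "A \<in> carrier (CW1 n)" "A' \<in> carrier (CW1 n)"
      then obtain p p' where p: "A = patch_class n p" "A' = patch_class n p'"
        by (auto simp: carrier)
      show "patch_iso n (A \<otimes>\<^bsub>CW1 n\<^esub> A') = patch_iso n A \<otimes>\<^bsub>?B\<^esub> patch_iso n A'"
        using patch_iso_patch_class[of n "p * p'"]
        by (simp only: ops p patch_class_simps patch_iso_patch_class patch_value_simps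
            Y.coord.fraction_mult patch_value_in_fractions)
      show "patch_iso n (A \<oplus>\<^bsub>CW1 n\<^esub> A') = patch_iso n A \<oplus>\<^bsub>?B\<^esub> patch_iso n A'"
        using patch_iso_patch_class[of n "p + p'"]
        by (simp only: ops p patch_class_simps patch_iso_patch_class patch_value_simps
            Y.coord.fraction_add patch_value_in_fractions)
    qed
    show "bij_betw (patch_iso n) (carrier (CW1 n)) (carrier ?B)"
      unfolding bij_betw_def
    proof
      show "inj_on (patch_iso n) (carrier (CW1 n))"
      proof (rule inj_onI)
        fix A A' assume A: "A \<in> carrier (CW1 n)" "A' \<in> carrier (CW1 n)" "patch_iso n A = patch_iso n A'"
        then obtain p p' where p: "A = patch_class n p" "A' = patch_class n p'"
          by (auto simp: carrier)
        then have "patch_value n p = patch_value n p'"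
          using A(3) inj_onD[OF Y.coord.fraction_inj _ patch_value_in_fractions patch_value_in_fractions]
          by (simp add: patch_iso_patch_class)
        then show "A = A'"
          by (simp add: p patch_value_def U.residue_class_eq_iff_ext)
      qed
      show "patch_iso n ` carrier (CW1 n) = carrier ?B"
        unfolding carrier carrier_blowup_patch_ring by (simp add: image_image patch_iso_patch_class)
    qed
  qed
qed

end
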